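(* Let $(K,|\cdot|)$ be an algebraically closed non-archimedean valued field of characteristic $0$. Let $f(z)\in K[z]$ be a polynomial of degree $n\ge 2$, and put $r_n=|n|^{-1/(n-1)}$, where $|n|$ is the absolute value of the integer $n$ viewed as an element of $K$. Assume that every zero $z_i$ of $f$ satisfies $|z_i|\le 1$. Then for each zero $z_i$ of $f$, the closed disk $\overline{\mathbb{D}}(z_i,r_n)=\{w\in K : |w-z_i|\le r_n\}$ contains at least one zero of the derivative $f'(z)$.
   Context: A non-archimedean field is a field with an absolute value satisfying $|x+y|\le\max\{|x|,|y|\}$. *)

theory Defs
  imports Complex_Main "HOL-Computational_Algebra.Polynomial"
begin

(* The trivial absolute value is allowed.  The normed classes do not apply: all of them, from
   real_normed_vector on, make the type a normed space over the reals. *)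
locale nonarch_absolute_value =
  fixes v :: "'a::field \<Rightarrow> real"
  assumes nonneg: "0 \<le> v x"
    and eq_zero_iff: "v x = 0 \<longleftrightarrow> x = 0"
    and mult: "v (x * y) = v x * v y"
    and ultrametric: "v (x + y) \<le> max (v x) (v y)"

definition closed_disk :: "('a::field \<Rightarrow> real) \<Rightarrow> 'a \<Rightarrow> real \<Rightarrow> 'a set" where
  "closed_disk v a r = {w. v (w - a) \<le> r}"

end

theory Submission
  imports Defs
begin

text \<open>
  Write \<open>f = a \<Prod>(X - z\<^sub>j)\<close> and \<open>f' = n a \<Prod>(X - w\<^sub>j)\<close>. Evaluating the derivative at a zero \<open>z\<^sub>i\<close>
  in both ways gives \<open>n \<Prod>\<^sub>j (z\<^sub>i - w\<^sub>j) = \<Prod>\<^bsub>j \<noteq> i\<^esub> (z\<^sub>i - z\<^sub>j)\<close>. The ultrametric inequality bounds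
  the right-hand side by \<open>1\<close>, so the \<open>n - 1\<close> distances \<open>|z\<^sub>i - w\<^sub>j|\<close> cannot all exceed \<open>r\<^sub>n\<close>.
\<close>

text \<open>On the empty multiset both sides are 1, so strictness only starts at singletons; this is
  why the induction step splits on \<open>A = {#}\<close>.\<close>

lemma power_less_prod_mset:
  fixes g :: "'b \<Rightarrow> real"
  assumes "A \<noteq> {#}" "0 \<le> r" "\<And>x. x \<in># A \<Longrightarrow> r < g x"
  shows "r ^ size A < (\<Prod>x\<in>#A. g x)"
  using assms
proof (induction A)
  case empty
  then show ?case by simp
next
  case (add x A)
  show ?case
  proof (cases "A = {#}")
    case True
    with add.prems show ?thesis by simp
  next
    case False
    with add have "r ^ size A < (\<Prod>x\<in>#A. g x)" by auto
    with add.prems show ?thesis by (auto intro: mult_strict_mono')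
  qed
qed

lemma prod_mset_le_1:
  fixes g :: "'b \<Rightarrow> real"
  assumes "\<And>x. x \<in># A \<Longrightarrow> 0 \<le> g x \<and> g x \<le> 1"
  shows "0 \<le> (\<Prod>x\<in>#A. g x) \<and> (\<Prod>x\<in>#A. g x) \<le> 1"
  using assms by (induction A) (auto intro: mult_le_one)

context nonarch_absolute_value
begin

lemma v_one: "v 1 = 1"
  using mult[of 1 1] eq_zero_iff[of 1] by simp

lemma v_minus: "v (- x) = v x"
proof -
  have "v (- 1) * v (- 1) = 1"
    using mult[of "- 1" "- 1"] v_one by simp
  then have "v (- 1) = 1"
    using nonneg[of "- 1"] by (metis abs_of_nonneg abs_1 square_eq_1_iff abs_minus)
  then show ?thesis
    using mult[of "- 1" x] by simp
qed

lemma v_diff_le: "v (x - y) \<le> max (v x) (v y)"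
  using ultrametric[of x "- y"] v_minus[of y] by simp

lemma v_prod_mset: "v (\<Prod>x\<in>#A. g x) = (\<Prod>x\<in>#A. v (g x))"
  by (induction A) (auto simp: v_one mult)

end

theorem theorem1:
  fixes v :: "'a::{alg_closed_field, field_char_0} \<Rightarrow> real"
    and f :: "'a poly"
    and n :: nat
  assumes "nonarch_absolute_value v"
    and "degree f = n"
    and "n \<ge> 2"
    and "\<And>z. poly f z = 0 \<Longrightarrow> v z \<le> 1"
  shows "\<forall>z. poly f z = 0 \<longrightarrow>
    (\<exists>w \<in> closed_disk v z (v (of_nat n) powr (- 1 / (real n - 1))). poly (pderiv f) w = 0)"
proof (intro allI impI, rule ccontr)
  interpret nonarch_absolute_value v by fact
  fix z
  define r where "r = v (of_nat n) powr (- 1 / (real n - 1))"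
  define a where "a = lead_coeff f"
  assume z: "poly f z = 0"
    and "\<not> (\<exists>w \<in> closed_disk v z (v (of_nat n) powr (- 1 / (real n - 1))).
          poly (pderiv f) w = 0)"
  then have far: "r < v (w - z)" if "poly (pderiv f) w = 0" for w
    using that by (force simp: closed_disk_def r_def)
  have f0: "f \<noteq> 0" and a0: "a \<noteq> 0"
    using assms(2,3) by (auto simp: a_def)
  \<comment> \<open>In characteristic 0 the coefficient \<open>of_nat n * a\<close> does not vanish,
    so the degree drops by exactly one.\<close>
  have deg: "degree (pderiv f) = n - 1"
    using assms(2) by (simp add: degree_pderiv)
  have f'0: "pderiv f \<noteq> 0"
    using assms(2,3) by (simp add: pderiv_eq_0_iff)
  have lc: "lead_coeff (pderiv f) = of_nat n * a"
    using assms(2,3) deg by (simp add: coeff_pderiv a_def del: of_nat_Suc)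

  obtain A where A: "f = smult a (\<Prod>x\<in>#A. [:- x, 1:])"
    using alg_closed_imp_factorization[OF f0] by (auto simp: a_def)
  obtain B where sB: "size B = n - 1"
    and B: "pderiv f = smult (of_nat n * a) (\<Prod>x\<in>#B. [:- x, 1:])"
    using alg_closed_imp_factorization[OF f'0] unfolding lc unfolding deg by auto
  have roots_A: "poly f x = 0 \<longleftrightarrow> x \<in># A" for x
    by (subst A) (auto simp: poly_prod_mset a0)
  have roots_B: "poly (pderiv f) x = 0" if "x \<in># B" for x
    by (subst B) (use that in \<open>auto simp: poly_prod_mset\<close>)
  \<comment> \<open>Only one copy of \<open>z\<close> is split off. If \<open>z\<close> is a
    multiple zero, it remains in \<open>C\<close> and the product over \<open>C\<close> is
    0.\<close>
  from z obtain C where C: "A = add_mset z C"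
    using roots_A by (meson multi_member_split)

  have "f = smult a ([:- z, 1:] * (\<Prod>x\<in>#C. [:- x, 1:]))"
    using A by (simp add: C)
  \<comment> \<open>By the product rule, the summand that keeps the factor \<open>[:- z, 1:]\<close>
    vanishes at \<open>z\<close>.\<close>
  then have "poly (pderiv f) z = a * (\<Prod>x\<in>#C. z - x)"
    by (simp add: pderiv_smult pderiv_mult pderiv_pCons poly_prod_mset del: mult_pCons_left)
  moreover have "poly (pderiv f) z = of_nat n * a * (\<Prod>x\<in>#B. z - x)"
    by (subst B) (simp add: poly_prod_mset)
  ultimately have "of_nat n * (\<Prod>x\<in>#B. z - x) = (\<Prod>x\<in>#C. z - x)"
    using a0 by simp
  then have eq: "v (of_nat n) * (\<Prod>x\<in>#B. v (z - x)) = (\<Prod>x\<in>#C. v (z - x))"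
    by (metis mult v_prod_mset)
  have "v (z - x) \<le> 1" if "x \<in># C" for x
    using v_diff_le[of z x] assms(4)[OF z] assms(4)[of x] roots_A[of x] that C by auto
  then have "(\<Prod>x\<in>#C. v (z - x)) \<le> 1"
    using prod_mset_le_1[of C "\<lambda>x. v (z - x)"] nonneg by auto
  \<comment> \<open>Characteristic 0 again: \<open>of_nat n\<close> is nonzero in the field. Hence
    also \<open>r > 0\<close>, which the passage from \<open>^\<close> to \<open>powr\<close>
    requires.\<close>
  moreover have npos: "v (of_nat n) > 0"
    using nonneg[of "of_nat n"] eq_zero_iff[of "of_nat n"] assms(3) by force
  moreover have "r ^ (n - 1) < (\<Prod>x\<in>#B. v (z - x))"
  proof -
    have "B \<noteq> {#}" using sB assms(3) by auto
    moreover have "r < v (z - x)" if "x \<in># B" for x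
      using far[OF roots_B[OF that]] v_minus[of "z - x"] by simp
    ultimately show ?thesis
      using power_less_prod_mset[of B r "\<lambda>x. v (z - x)"] by (simp add: sB r_def)
  qed
  \<comment> \<open>The exponent in \<open>r\<close> is chosen to make this hold.\<close>
  moreover have "r ^ (n - 1) = 1 / v (of_nat n)"
  proof -
    have "r ^ (n - 1) = r powr real (n - 1)"
      using npos by (subst powr_realpow) (auto simp: r_def)
    also have "\<dots> = v (of_nat n) powr (- 1)"
      using assms(3) by (simp add: r_def powr_powr of_nat_diff)
    finally show ?thesis
      using npos by (simp add: powr_minus_divide)
  qed
  \<comment> \<open>Multiplying the strict bound by \<open>v (of_nat n)\<close> makes the left side
    of \<open>eq\<close> exceed 1, while its right side is at most 1.\<close>
  ultimately show False
    using eq mult_strict_left_mono[of "r ^ (n - 1)" "\<Prod>x\<in>#B. v (z - x)" "v (of_nat n)"]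
    by simp
qed

end
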